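(* Let $a>0$, $\tfrac12<\alpha<1$, $\lambda>0$. Let $u_0:\mathbb{R}\to\mathbb{R}$ be a non-random, non-negative, bounded function for which there is a constant $c>0$ with $u_0(x)>c$ for all $x\in\mathbb{R}$. Let $\sigma:\mathbb{R}\to\mathbb{R}$ be globally Lipschitz continuous and suppose there is a finite constant $L_\sigma>0$ such that $|\sigma(x)|\ge L_\sigma|x|$ for all $x\in\mathbb{R}$. Let $u$ be an $L^2$-continuous solution of $$T^a_{\alpha,t}u(x,t)=\lambda\,\sigma(u(x,t))\,\dot W_t,\qquad x\in\mathbb{R},\ t>a,$$ with initial condition $u_0$. Then there exists a constant $c_3>0$ such that, with $c_4=\frac{\lambda^2L_\sigma^2}{2\alpha-1}$, for all $t\in[a,\infty)$, $$\inf_{x\in\mathbb{R}}\mathbb{E}|u(x,t)|^2\ \ge\ c_3\exp\big(c_4(t-a)^{2\alpha-1}\big).$$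
   Context: $(W_t)_{t\ge 0}$ is a standard one-dimensional Wiener process with its filtration and $\dot W_t$ its generalized derivative; $T^a_{\alpha,t}v(x,t)=\lim_{\epsilon\to0}\frac{v(x,t+\epsilon(t-a)^{1-\alpha})-v(x,t)}{\epsilon}$ is the conformable time-fractional derivative of order $\alpha$ starting from $a$. A solution of the equation is understood in the mild sense: a random field $u=(u(x,t))_{x\in\mathbb{R},t\ge a}$ such that for each $x$ the process $t\mapsto u(x,t)$ is predictable, $\int_a^t(s-a)^{2(\alpha-1)}\mathbb{E}|\sigma(u(x,s))|^2\,ds<\infty$ for all $t\geq a$, and, almost surely for each $x\in\mathbb{R}$ and $t\ge a$, $$u(x,t)=u_0(x)+\lambda\int_a^t(s-a)^{\alpha-1}\sigma(u(x,s))\,dW_s\quad\text{(It\^o integral)}.$$ $u$ is $L^2$-continuous if $\mathbb{E}|u(x,t)|^2<\infty$ for all $(x,t)$ and $(x,t)\mapsto u(x,t)\in L^2(\mathbb{P})$ is continuous. *)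

theory Defs
  imports "HOL-Probability.Probability"
begin

text \<open>
  A standard one-dimensional Wiener process \<open>W\<close> relative to a filtration \<open>F\<close>.  Both the filtration
  generated by \<open>W\<close> and its completion satisfy these conditions.  Time is \<open>[0, \<infinity>)\<close>; since the
  library filtrations are indexed by a whole type, a filtration \<open>(F t)\<close> with \<open>t \<ge> 0\<close> is viewed as a
  real-indexed one by, e.g., setting \<open>F t = F 0\<close> for \<open>t < 0\<close>.
\<close>

locale wiener_process = prob_space M + filtration "space M" F
  for M :: "'a measure" and F :: "real \<Rightarrow> 'a measure" +
  fixes W :: "real \<Rightarrow> 'a \<Rightarrow> real"
  assumes subalgebra_F: "\<And>t. subalgebra M (F t)"
    and adapted: "\<And>t. 0 \<le> t \<Longrightarrow> W t \<in> borel_measurable (F t)"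
    and start_zero: "AE \<omega> in M. W 0 \<omega> = 0"
    and continuous_paths: "AE \<omega> in M. continuous_on {0..} (\<lambda>t. W t \<omega>)"
    and normal_increments: "\<And>s t. 0 \<le> s \<Longrightarrow> s < t \<Longrightarrow>
      distributed M lborel (\<lambda>\<omega>. W t \<omega> - W s \<omega>) (normal_density 0 (sqrt (t - s)))"
    and indep_increments: "\<And>s t. 0 \<le> s \<Longrightarrow> s < t \<Longrightarrow>
      indep_set (sets (F s)) {(\<lambda>\<omega>. W t \<omega> - W s \<omega>) -` A \<inter> space M | A. A \<in> sets borel}"

text \<open>The predictable \<open>\<sigma>\<close>-algebra on \<open>[a, \<infinity>) \<times> \<Omega>\<close>.\<close>

definition predictable_algebra ::
    "'a measure \<Rightarrow> (real \<Rightarrow> 'a measure) \<Rightarrow> real \<Rightarrow> (real \<times> 'a) measure" where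
  "predictable_algebra M F a = sigma ({a..} \<times> space M)
     ({{a} \<times> A | A. A \<in> sets (F a)} \<union> {{s<..t} \<times> A | s t A. a \<le> s \<and> s \<le> t \<and> A \<in> sets (F s)})"

definition predictable_process ::
    "'a measure \<Rightarrow> (real \<Rightarrow> 'a measure) \<Rightarrow> real \<Rightarrow> (real \<Rightarrow> 'a \<Rightarrow> real) \<Rightarrow> bool" where
  "predictable_process M F a X \<longleftrightarrow>
     (\<lambda>(t, \<omega>). X t \<omega>) \<in> borel_measurable (predictable_algebra M F a)"

text \<open>
  Elementary integrands on \<open>[a, b]\<close>: the process \<open>\<Sum>i<n. \<xi> i * 1_(\<tau> i, \<tau> (i+1)]\<close> with a nondecreasing
  partition and bounded weights \<open>\<xi> i\<close> known at time \<open>\<tau> i\<close>.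
\<close>

definition elementary_data ::
    "'a measure \<Rightarrow> (real \<Rightarrow> 'a measure) \<Rightarrow> real \<Rightarrow> real \<Rightarrow>
     nat \<Rightarrow> (nat \<Rightarrow> real) \<Rightarrow> (nat \<Rightarrow> 'a \<Rightarrow> real) \<Rightarrow> bool" where
  "elementary_data M F a b n \<tau> \<xi> \<longleftrightarrow>
     a \<le> \<tau> 0 \<and> (\<forall>i<n. \<tau> i \<le> \<tau> (Suc i)) \<and> \<tau> n \<le> b \<and>
     (\<forall>i<n. \<xi> i \<in> borel_measurable (F (\<tau> i)) \<and> (\<exists>B. \<forall>\<omega>\<in>space M. \<bar>\<xi> i \<omega>\<bar> \<le> B))"

definition elementary_process ::
    "nat \<Rightarrow> (nat \<Rightarrow> real) \<Rightarrow> (nat \<Rightarrow> 'a \<Rightarrow> real) \<Rightarrow> real \<Rightarrow> 'a \<Rightarrow> real" where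
  "elementary_process n \<tau> \<xi> s \<omega> = (\<Sum>i<n. \<xi> i \<omega> * indicator {\<tau> i<..\<tau> (Suc i)} s)"

definition elementary_integral ::
    "(real \<Rightarrow> 'a \<Rightarrow> real) \<Rightarrow> nat \<Rightarrow> (nat \<Rightarrow> real) \<Rightarrow> (nat \<Rightarrow> 'a \<Rightarrow> real) \<Rightarrow> 'a \<Rightarrow> real" where
  "elementary_integral W n \<tau> \<xi> \<omega> = (\<Sum>i<n. \<xi> i \<omega> * (W (\<tau> (Suc i)) \<omega> - W (\<tau> i) \<omega>))"

text \<open>
  \<open>I\<close> is (a version of) the Ito integral of the predictable integrand \<open>H\<close> over \<open>[a, b]\<close>: the
  limit in \<open>L\<^sup>2(P)\<close> of the integrals of elementary integrands that converge to \<open>H\<close> in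
  \<open>L\<^sup>2([a, b] \<times> \<Omega>, ds \<otimes> P)\<close>.  By the Ito isometry \<open>I\<close> is unique up to null sets, and it exists as soon
  as the predictable \<open>H\<close> is square integrable over \<open>[a, b] \<times> \<Omega>\<close>.
\<close>

definition has_ito_integral ::
    "'a measure \<Rightarrow> (real \<Rightarrow> 'a measure) \<Rightarrow> (real \<Rightarrow> 'a \<Rightarrow> real) \<Rightarrow> real \<Rightarrow> real \<Rightarrow>
     (real \<Rightarrow> 'a \<Rightarrow> real) \<Rightarrow> ('a \<Rightarrow> real) \<Rightarrow> bool" where
  "has_ito_integral M F W a b H I \<longleftrightarrow>
     predictable_process M F a (\<lambda>s \<omega>. indicator {a..b} s * H s \<omega>) \<and>
     I \<in> borel_measurable M \<and>
     (\<exists>n \<tau> \<xi>. (\<forall>k. elementary_data M F a b (n k) (\<tau> k) (\<xi> k)) \<and>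
        (\<lambda>k. \<integral>\<^sup>+s\<in>{a..b}.
            (\<integral>\<^sup>+\<omega>. ennreal ((elementary_process (n k) (\<tau> k) (\<xi> k) s \<omega> - H s \<omega>)\<^sup>2) \<partial>M) \<partial>lborel)
          \<longlonglongrightarrow> 0 \<and>
        (\<lambda>k. \<integral>\<^sup>+\<omega>. ennreal ((elementary_integral W (n k) (\<tau> k) (\<xi> k) \<omega> - I \<omega>)\<^sup>2) \<partial>M)
          \<longlonglongrightarrow> 0)"

text \<open>
  Mild solutions, on \<open>\<real> \<times> [a, \<infinity>)\<close>, of the equation with conformable time derivative of order \<open>\<alpha>\<close>
  started at \<open>a\<close>, noise term \<open>\<lambda> \<sigma>(u) dW/dt\<close> and initial condition \<open>u0\<close>; \<open>lam\<close> stands for \<open>\<lambda>\<close>.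
  The exceptional null set may depend on \<open>(x, t)\<close>.
\<close>

definition mild_solution ::
    "'a measure \<Rightarrow> (real \<Rightarrow> 'a measure) \<Rightarrow> (real \<Rightarrow> 'a \<Rightarrow> real) \<Rightarrow> real \<Rightarrow> real \<Rightarrow> real \<Rightarrow>
     (real \<Rightarrow> real) \<Rightarrow> (real \<Rightarrow> real) \<Rightarrow> (real \<Rightarrow> real \<Rightarrow> 'a \<Rightarrow> real) \<Rightarrow> bool" where
  "mild_solution M F W a \<alpha> lam \<sigma> u0 u \<longleftrightarrow>
     (\<forall>x. \<forall>t\<ge>a. u x t \<in> borel_measurable M) \<and>
     (\<forall>x. predictable_process M F a (u x)) \<and>
     (\<forall>x. \<forall>t\<ge>a. (\<integral>\<^sup>+s\<in>{a..t}. ennreal ((s - a) powr (2 * (\<alpha> - 1))) *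
         (\<integral>\<^sup>+\<omega>. ennreal (\<bar>\<sigma> (u x s \<omega>)\<bar>\<^sup>2) \<partial>M) \<partial>lborel) < \<infinity>) \<and>
     (\<forall>x. \<forall>t\<ge>a. \<exists>I.
         has_ito_integral M F W a t (\<lambda>s \<omega>. (s - a) powr (\<alpha> - 1) * \<sigma> (u x s \<omega>)) I \<and>
         (AE \<omega> in M. u x t \<omega> = u0 x + lam * I \<omega>))"

text \<open>
  Continuity of \<open>(x, t) \<mapsto> u(x, t) \<in> L\<^sup>2(P)\<close> on \<open>\<real> \<times> [a, \<infinity>)\<close>, with the convergence in \<open>L\<^sup>2\<close> expressed
  by squared distances.
\<close>

definition L2_continuous :: "'a measure \<Rightarrow> real \<Rightarrow> (real \<Rightarrow> real \<Rightarrow> 'a \<Rightarrow> real) \<Rightarrow> bool" where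
  "L2_continuous M a u \<longleftrightarrow>
     (\<forall>x. \<forall>t\<ge>a. u x t \<in> borel_measurable M \<and> integrable M (\<lambda>\<omega>. \<bar>u x t \<omega>\<bar>\<^sup>2)) \<and>
     (\<forall>x. \<forall>t\<ge>a. ((\<lambda>(y, s). \<integral>\<omega>. \<bar>u y s \<omega> - u x t \<omega>\<bar>\<^sup>2 \<partial>M) \<longlongrightarrow> 0)
        (at (x, t) within UNIV \<times> {a..}))"

end

theory Submission
  imports Defs
begin

text \<open>
  Fix \<open>x\<close> and put \<open>g(t) = E|u(x,t)|\<^sup>2\<close>.  The initial value is deterministic and an Ito integral has
  mean zero, so squaring the mild formulation and applying the Ito isometry leaves no cross term:
  \<open>g(t) = u0(x)\<^sup>2 + \<lambda>\<^sup>2 \<integral>\<^sub>a\<^sup>t (s - a)\<^bsup>2(\<alpha> - 1)\<^esup> E|\<sigma>(u(x,s))|\<^sup>2 ds\<close>.  The lower bounds on \<open>u0\<close> and \<open>\<sigma>\<close> turn this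
  identity into the linear integral inequality
  \<open>g(t) \<ge> c\<^sup>2 + \<lambda>\<^sup>2 L\<^sup>2 \<integral>\<^sub>a\<^sup>t (s - a)\<^bsup>2\<alpha> - 2\<^esup> g(s) ds\<close>, whose minimal solution is
  \<open>c\<^sup>2 exp(\<lambda>\<^sup>2 L\<^sup>2 (t - a)\<^bsup>2\<alpha> - 1\<^esup> / (2\<alpha> - 1))\<close>.  None of the constants depends on \<open>x\<close>, hence the bound
  passes to the infimum with the constant \<open>c\<^sup>2\<close> in front.

  The integral inequality is iterated (\<open>reverse_gronwall_powr\<close>): each iteration adds one term
  of the exponential series, by monotonicity of the integral in \<open>[0, \<infinity>]\<close>.

  The Ito isometry and the vanishing mean (\<open>ito_isometry\<close>, \<open>expectation_ito_integral\<close>) are proved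
  first for elementary integrands, where they express that an increment of \<open>W\<close> is centred, has
  variance equal to the elapsed time, and is independent of the past; they then pass to \<open>L\<^sup>2\<close> limits.
\<close>

section \<open>Limits of isometries in square mean\<close>

text \<open>
  The triangle inequality in \<open>L\<^sup>2\<close> in a form free of square roots, which stays meaningful when the
  norms are infinite.  Pointwise it is Young's inequality for the cross term of
  \<open>Y\<^sup>2 = (X + (Y - X))\<^sup>2\<close>.
\<close>

lemma nn_integral_square_le_perturbed:
  fixes X Y :: "'b \<Rightarrow> real"
  assumes [measurable]: "X \<in> borel_measurable N" "Y \<in> borel_measurable N" and "\<delta> > 0"
  shows "(\<integral>\<^sup>+z. ennreal ((Y z)\<^sup>2) \<partial>N) \<le>
    ennreal (1 + \<delta>) * (\<integral>\<^sup>+z. ennreal ((X z)\<^sup>2) \<partial>N) +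
    ennreal (1 + 1 / \<delta>) * (\<integral>\<^sup>+z. ennreal ((X z - Y z)\<^sup>2) \<partial>N)"
proof -
  have young: "y\<^sup>2 \<le> (1 + \<delta>) * x\<^sup>2 + (1 + 1 / \<delta>) * (x - y)\<^sup>2" for x y :: real
  proof -
    have "0 \<le> (\<delta> * x - (y - x))\<^sup>2 / \<delta>"
      using \<open>\<delta> > 0\<close> by simp
    also have "\<dots> = (1 + \<delta>) * x\<^sup>2 + (1 + 1 / \<delta>) * (x - y)\<^sup>2 - y\<^sup>2"
      using \<open>\<delta> > 0\<close> by (simp add: field_simps power2_eq_square)
    finally show ?thesis by simp
  qed
  have "(\<integral>\<^sup>+z. ennreal ((Y z)\<^sup>2) \<partial>N) \<le>
      (\<integral>\<^sup>+z. ennreal (1 + \<delta>) * ennreal ((X z)\<^sup>2) + ennreal (1 + 1 / \<delta>) * ennreal ((X z - Y z)\<^sup>2) \<partial>N)"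
  proof (rule nn_integral_mono)
    fix z
    have "ennreal ((Y z)\<^sup>2) \<le> ennreal ((1 + \<delta>) * (X z)\<^sup>2 + (1 + 1 / \<delta>) * (X z - Y z)\<^sup>2)"
      by (rule ennreal_leI[OF young])
    also have "\<dots> = ennreal (1 + \<delta>) * ennreal ((X z)\<^sup>2) + ennreal (1 + 1 / \<delta>) * ennreal ((X z - Y z)\<^sup>2)"
      using \<open>\<delta> > 0\<close> by (simp add: ennreal_plus ennreal_mult)
    finally show "ennreal ((Y z)\<^sup>2) \<le>
      ennreal (1 + \<delta>) * ennreal ((X z)\<^sup>2) + ennreal (1 + 1 / \<delta>) * ennreal ((X z - Y z)\<^sup>2)" .
  qed
  also have "\<dots> = ennreal (1 + \<delta>) * (\<integral>\<^sup>+z. ennreal ((X z)\<^sup>2) \<partial>N) +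
    ennreal (1 + 1 / \<delta>) * (\<integral>\<^sup>+z. ennreal ((X z - Y z)\<^sup>2) \<partial>N)"
    by (simp add: nn_integral_add nn_integral_cmult)
  finally show ?thesis .
qed

text \<open>
  Both norms are perturbed with the same \<open>\<delta>\<close>: from \<open>Y\<close> to \<open>X k\<close>, across the isometry to \<open>A k\<close>, and on to
  \<open>B\<close>.  Letting \<open>k \<rightarrow> \<infinity>\<close> removes the error terms at the price of a factor \<open>(1 + \<delta>)\<^sup>2\<close>, and then
  \<open>\<delta> \<rightarrow> 0\<close>.
\<close>

lemma L2_limit_isometry_le:
  fixes X :: "nat \<Rightarrow> 'b \<Rightarrow> real" and Y :: "'b \<Rightarrow> real"
    and A :: "nat \<Rightarrow> 'c \<Rightarrow> real" and B :: "'c \<Rightarrow> real"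
  assumes [measurable]: "\<And>k. X k \<in> borel_measurable N" "Y \<in> borel_measurable N"
      "\<And>k. A k \<in> borel_measurable N'" "B \<in> borel_measurable N'"
    and iso: "\<And>k. (\<integral>\<^sup>+z. ennreal ((X k z)\<^sup>2) \<partial>N) = (\<integral>\<^sup>+z. ennreal ((A k z)\<^sup>2) \<partial>N')"
    and limX: "(\<lambda>k. \<integral>\<^sup>+z. ennreal ((X k z - Y z)\<^sup>2) \<partial>N) \<longlonglongrightarrow> 0"
    and limA: "(\<lambda>k. \<integral>\<^sup>+z. ennreal ((A k z - B z)\<^sup>2) \<partial>N') \<longlonglongrightarrow> 0"
  shows "(\<integral>\<^sup>+z. ennreal ((Y z)\<^sup>2) \<partial>N) \<le> (\<integral>\<^sup>+z. ennreal ((B z)\<^sup>2) \<partial>N')" (is "?Y \<le> ?B")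
proof (cases "?B = \<infinity>")
  case False
  have bound: "?Y \<le> ennreal ((1 + \<delta>)\<^sup>2) * ?B" if "\<delta> > 0" for \<delta> :: real
  proof -
    let ?dX = "\<lambda>k. \<integral>\<^sup>+z. ennreal ((X k z - Y z)\<^sup>2) \<partial>N"
    let ?dA = "\<lambda>k. \<integral>\<^sup>+z. ennreal ((A k z - B z)\<^sup>2) \<partial>N'"
    let ?C = "ennreal (1 + 1 / \<delta>)" and ?D = "ennreal (1 + \<delta>)"
    have le: "?Y \<le> ?D * (?D * ?B + ?C * ?dA k) + ?C * ?dX k" for k
    proof -
      have swap: "(\<integral>\<^sup>+z. ennreal ((B z - A k z)\<^sup>2) \<partial>N') = ?dA k"
        by (simp add: power2_commute)
      have "?Y \<le> ?D * (\<integral>\<^sup>+z. ennreal ((A k z)\<^sup>2) \<partial>N') + ?C * ?dX k"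
        using nn_integral_square_le_perturbed[of "X k" N Y \<delta>] that by (simp add: iso)
      also have "(\<integral>\<^sup>+z. ennreal ((A k z)\<^sup>2) \<partial>N') \<le> ?D * ?B + ?C * ?dA k"
        using nn_integral_square_le_perturbed[of B N' "A k" \<delta>] that by (simp add: swap)
      finally show ?thesis
        by (simp add: add_right_mono mult_left_mono)
    qed
    have "(\<lambda>k. ?D * (?D * ?B + ?C * ?dA k) + ?C * ?dX k) \<longlonglongrightarrow> ?D * (?D * ?B + ?C * 0) + ?C * 0"
      using limX limA by (intro tendsto_add ennreal_tendsto_cmult tendsto_const) simp_all
    then have "?Y \<le> ?D * (?D * ?B + ?C * 0) + ?C * 0"
      by (rule LIMSEQ_le_const) (use le in auto)
    also have "\<dots> = ennreal ((1 + \<delta>)\<^sup>2) * ?B"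
      using that by (simp add: power2_eq_square ennreal_mult mult.assoc)
    finally show ?thesis .
  qed
  have "(\<lambda>n. (1 + inverse (real (Suc n)))\<^sup>2) \<longlonglongrightarrow> (1 + 0)\<^sup>2"
    by (intro tendsto_intros LIMSEQ_inverse_real_of_nat)
  then have "(\<lambda>n. ennreal ((1 + inverse (real (Suc n)))\<^sup>2)) \<longlonglongrightarrow> ennreal 1"
    by (intro tendsto_ennrealI) simp
  then have "(\<lambda>n. ?B * ennreal ((1 + inverse (real (Suc n)))\<^sup>2)) \<longlonglongrightarrow> ?B * ennreal 1"
    by (rule ennreal_tendsto_cmult[rotated]) (use False in \<open>simp add: less_top\<close>)
  then have "?Y \<le> ?B * ennreal 1"
    by (rule LIMSEQ_le_const) (use bound in \<open>simp add: mult.commute[of ?B] del: of_nat_Suc\<close>)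
  then show ?thesis by simp
qed simp

lemma L2_limit_isometry:
  fixes X :: "nat \<Rightarrow> 'b \<Rightarrow> real" and Y :: "'b \<Rightarrow> real"
    and A :: "nat \<Rightarrow> 'c \<Rightarrow> real" and B :: "'c \<Rightarrow> real"
  assumes "\<And>k. X k \<in> borel_measurable N" "Y \<in> borel_measurable N"
      "\<And>k. A k \<in> borel_measurable N'" "B \<in> borel_measurable N'"
    and "\<And>k. (\<integral>\<^sup>+z. ennreal ((X k z)\<^sup>2) \<partial>N) = (\<integral>\<^sup>+z. ennreal ((A k z)\<^sup>2) \<partial>N')"
    and "(\<lambda>k. \<integral>\<^sup>+z. ennreal ((X k z - Y z)\<^sup>2) \<partial>N) \<longlonglongrightarrow> 0"
    and "(\<lambda>k. \<integral>\<^sup>+z. ennreal ((A k z - B z)\<^sup>2) \<partial>N') \<longlonglongrightarrow> 0"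
  shows "(\<integral>\<^sup>+z. ennreal ((Y z)\<^sup>2) \<partial>N) = (\<integral>\<^sup>+z. ennreal ((B z)\<^sup>2) \<partial>N')"
  by (intro antisym L2_limit_isometry_le[of X N Y A N' B] L2_limit_isometry_le[of A N' B X N Y])
    (simp_all add: assms)

section \<open>Elementary integrals\<close>

lemma elementary_data_partition:
  assumes "elementary_data M F a b n \<tau> \<xi>" "i \<le> n"
  shows "a \<le> \<tau> i" "\<tau> i \<le> \<tau> n"
proof -
  have step: "\<tau> j \<le> \<tau> (Suc j)" if "j < n" for j
    using assms(1) that by (simp add: elementary_data_def)
  show "\<tau> i \<le> \<tau> n"
    using assms(2) by (induction rule: inc_induct) (use step in force)+
  have "\<tau> 0 \<le> \<tau> i"
    using assms(2)
  proof (induction i)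
    case (Suc i)
    then show ?case using step[of i] by simp
  qed simp
  then show "a \<le> \<tau> i"
    using assms(1) by (simp add: elementary_data_def)
qed

lemma elementary_data_Suc:
  assumes "elementary_data M F a b (Suc n) \<tau> \<xi>"
  shows "elementary_data M F a b n \<tau> \<xi>"
  using assms by (auto simp: elementary_data_def intro: order_trans)

lemma elementary_process_outside:
  assumes "elementary_data M F a b n \<tau> \<xi>" "s \<notin> {a..\<tau> n}"
  shows "elementary_process n \<tau> \<xi> s \<omega> = 0"
  unfolding elementary_process_def
proof (intro sum.neutral ballI)
  fix i assume "i \<in> {..<n}"
  then have "a \<le> \<tau> i" "\<tau> (Suc i) \<le> \<tau> n"
    using elementary_data_partition[OF assms(1)] by simp_all
  then show "\<xi> i \<omega> * indicator {\<tau> i<..\<tau> (Suc i)} s = 0"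
    using assms(2) by (auto simp: indicator_def)
qed

context wiener_process
begin

lemma borel_measurable_F_imp_M: "X \<in> borel_measurable (F t) \<Longrightarrow> X \<in> borel_measurable M"
  using subalgebra_F measurable_from_subalg by blast

lemma borel_measurable_F_mono:
  assumes "s \<le> t" "X \<in> borel_measurable (F s)"
  shows "X \<in> borel_measurable (F t)"
  using assms sets_F_mono[OF assms(1)] by (auto simp: measurable_def space_F)

lemma elementary_weight:
  assumes "elementary_data M F a b n \<tau> \<xi>" "i < n"
  shows "\<xi> i \<in> borel_measurable (F (\<tau> i))"
    and "integrable M (\<xi> i)" "integrable M (\<lambda>\<omega>. (\<xi> i \<omega>)\<^sup>2)"
    and "\<exists>B. \<forall>\<omega>\<in>space M. \<bar>\<xi> i \<omega>\<bar> \<le> B"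
proof -
  show meas: "\<xi> i \<in> borel_measurable (F (\<tau> i))" and bounded: "\<exists>B. \<forall>\<omega>\<in>space M. \<bar>\<xi> i \<omega>\<bar> \<le> B"
    using assms by (simp_all add: elementary_data_def)
  have [measurable]: "\<xi> i \<in> borel_measurable M"
    by (rule borel_measurable_F_imp_M[OF meas])
  from bounded obtain B where B: "\<And>\<omega>. \<omega> \<in> space M \<Longrightarrow> \<bar>\<xi> i \<omega>\<bar> \<le> B"
    by blast
  show sq: "integrable M (\<lambda>\<omega>. (\<xi> i \<omega>)\<^sup>2)"
  proof (rule integrable_const_bound)
    show "AE \<omega> in M. norm ((\<xi> i \<omega>)\<^sup>2) \<le> B\<^sup>2"
      using power_mono[OF B, of _ 2] by (intro AE_I2) simp
  qed simp
  show "integrable M (\<xi> i)"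
    using sq by (rule square_integrable_imp_integrable[rotated]) simp
qed

lemma increment_moments:
  assumes "0 \<le> s" "s \<le> t"
  shows "integrable M (\<lambda>\<omega>. (W t \<omega> - W s \<omega>)\<^sup>2)"
    and "expectation (\<lambda>\<omega>. W t \<omega> - W s \<omega>) = 0"
    and "expectation (\<lambda>\<omega>. (W t \<omega> - W s \<omega>)\<^sup>2) = t - s"
proof -
  have *: "integrable M (\<lambda>\<omega>. (W t \<omega> - W s \<omega>)\<^sup>2) \<and> expectation (\<lambda>\<omega>. W t \<omega> - W s \<omega>) = 0 \<and>
      expectation (\<lambda>\<omega>. (W t \<omega> - W s \<omega>)\<^sup>2) = t - s" if "s < t"
  proof -
    note D = normal_increments[OF assms(1) that]
    have pos: "0 < sqrt (t - s)" using that by simp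
    have int: "integrable M (\<lambda>\<omega>. (W t \<omega> - W s \<omega>)\<^sup>2)"
      using distributed_integrable[OF D, of "\<lambda>x. x\<^sup>2"] integrable_normal_moment[OF pos, of 0 2]
      by (simp add: normal_density_nonneg)
    have mean: "expectation (\<lambda>\<omega>. W t \<omega> - W s \<omega>) = 0"
      by (rule normal_distributed_expectation[OF pos D])
    have "variance (\<lambda>\<omega>. W t \<omega> - W s \<omega>) = (sqrt (t - s))\<^sup>2"
      by (rule normal_distributed_variance[OF pos D])
    with mean int that show ?thesis by simp
  qed
  show "integrable M (\<lambda>\<omega>. (W t \<omega> - W s \<omega>)\<^sup>2)"
    and "expectation (\<lambda>\<omega>. W t \<omega> - W s \<omega>) = 0"
    and "expectation (\<lambda>\<omega>. (W t \<omega> - W s \<omega>)\<^sup>2) = t - s"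
    using * assms(2) by (cases "s = t"; simp)+
qed

lemma borel_measurable_increment:
  assumes "0 \<le> s" "s \<le> t"
  shows "(\<lambda>\<omega>. W t \<omega> - W s \<omega>) \<in> borel_measurable (F t)"
  using assms by (intro borel_measurable_diff adapted borel_measurable_F_mono[of s t "W s"]) auto

text \<open>
  Independence of the \<open>\<sigma>\<close>-algebra at time \<open>s\<close> and the preimages under the increment, transferred to
  random variables: a variable known at time \<open>s\<close> generates a smaller \<open>\<sigma>\<close>-algebra, and the
  preimages under the increment already form one.
\<close>

lemma increment_indep_past:
  assumes "0 \<le> s" "s < t" "X \<in> borel_measurable (F s)"
  shows "indep_var borel X borel (\<lambda>\<omega>. W t \<omega> - W s \<omega>)"
proof -
  let ?D = "\<lambda>\<omega>. W t \<omega> - W s \<omega>"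
  have [measurable]: "X \<in> borel_measurable M" "?D \<in> borel_measurable M"
    using assms borel_measurable_F_imp_M borel_measurable_increment[of s t] by auto
  have past: "sigma_sets (space M) {X -` A \<inter> space M |A. A \<in> sets borel} \<subseteq> sets (F s)"
  proof -
    have "X -` A \<inter> space M \<in> sets (F s)" if "A \<in> sets borel" for A
      using measurable_sets[OF assms(3) that] by (simp add: space_F)
    then show ?thesis
      using sets.sigma_sets_subset[of "{X -` A \<inter> space M |A. A \<in> sets borel}" "F s"]
      by (auto simp: space_F)
  qed
  have incr: "sigma_sets (space M) {?D -` A \<inter> space M |A. A \<in> sets borel} =
      {?D -` A \<inter> space M |A. A \<in> sets borel}"
    using sigma_sets_vimage_commute[of ?D "space M" UNIV "sets borel"]
    unfolding sets.sigma_sets_eq[of "borel :: real measure", unfolded space_borel] by simp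
  have "indep_set (sigma_sets (space M) {X -` A \<inter> space M |A. A \<in> sets borel})
      (sigma_sets (space M) {?D -` A \<inter> space M |A. A \<in> sets borel})"
    unfolding incr
  proof (rule indep_setI)
    note ind = indep_increments[OF assms(1,2)]
    show "sigma_sets (space M) {X -` A \<inter> space M |A. A \<in> sets borel} \<subseteq> events"
      using past indep_setD_ev1[OF ind] by (rule order_trans)
    show "{?D -` A \<inter> space M |A. A \<in> sets borel} \<subseteq> events"
      by (rule indep_setD_ev2[OF ind])
    show "prob (A \<inter> B) = prob A * prob B"
      if "A \<in> sigma_sets (space M) {X -` A \<inter> space M |A. A \<in> sets borel}"
        "B \<in> {?D -` A \<inter> space M |A. A \<in> sets borel}" for A B
      using subsetD[OF past that(1)] that(2) by (rule indep_setD[OF ind])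
  qed
  then show ?thesis
    by (simp add: indep_var_eq)
qed

lemma expectation_past_times_increment:
  assumes "0 \<le> s" "s \<le> t" "X \<in> borel_measurable (F s)" "integrable M X"
  shows "integrable M (\<lambda>\<omega>. X \<omega> * (W t \<omega> - W s \<omega>))"
    and "expectation (\<lambda>\<omega>. X \<omega> * (W t \<omega> - W s \<omega>)) = 0"
    and "integrable M (\<lambda>\<omega>. X \<omega> * (W t \<omega> - W s \<omega>)\<^sup>2)"
    and "expectation (\<lambda>\<omega>. X \<omega> * (W t \<omega> - W s \<omega>)\<^sup>2) = expectation X * (t - s)"
proof -
  let ?D = "\<lambda>\<omega>. W t \<omega> - W s \<omega>"
  have *: "integrable M (\<lambda>\<omega>. X \<omega> * ?D \<omega>) \<and> expectation (\<lambda>\<omega>. X \<omega> * ?D \<omega>) = 0 \<and>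
      integrable M (\<lambda>\<omega>. X \<omega> * (?D \<omega>)\<^sup>2) \<and>
      expectation (\<lambda>\<omega>. X \<omega> * (?D \<omega>)\<^sup>2) = expectation X * (t - s)" if "s < t"
  proof -
    note indep = increment_indep_past[OF assms(1) that assms(3)]
    have "indep_var borel (id \<circ> X) borel ((\<lambda>x. x\<^sup>2) \<circ> ?D)"
      by (rule indep_var_compose[OF indep]) simp_all
    then have indep2: "indep_var borel X borel (\<lambda>\<omega>. (?D \<omega>)\<^sup>2)"
      by (simp add: comp_def)
    have intD: "integrable M ?D"
      by (rule square_integrable_imp_integrable[OF borel_measurable_F_imp_M
            [OF borel_measurable_increment[OF assms(1,2)]] increment_moments(1)[OF assms(1,2)]])
    show ?thesis
      using indep_var_integrable[OF indep assms(4) intD]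
        indep_var_lebesgue_integral[OF indep assms(4) intD]
        indep_var_integrable[OF indep2 assms(4) increment_moments(1)[OF assms(1,2)]]
        indep_var_lebesgue_integral[OF indep2 assms(4) increment_moments(1)[OF assms(1,2)]]
        increment_moments(2,3)[OF assms(1,2)]
      by simp
  qed
  show "integrable M (\<lambda>\<omega>. X \<omega> * (W t \<omega> - W s \<omega>))"
    and "expectation (\<lambda>\<omega>. X \<omega> * (W t \<omega> - W s \<omega>)) = 0"
    and "integrable M (\<lambda>\<omega>. X \<omega> * (W t \<omega> - W s \<omega>)\<^sup>2)"
    and "expectation (\<lambda>\<omega>. X \<omega> * (W t \<omega> - W s \<omega>)\<^sup>2) = expectation X * (t - s)"
    using * assms(2) by (cases "s = t"; simp)+
qed

text \<open>
  Orthogonality of the increments: the integral over the first \<open>n\<close> intervals is known at time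
  \<open>\<tau> n\<close>, so that its product with the next summand is a past variable times an independent
  centred increment and has mean zero.
\<close>

lemma elementary_integral_moments:
  assumes "0 \<le> a" "elementary_data M F a b n \<tau> \<xi>"
  shows "elementary_integral W n \<tau> \<xi> \<in> borel_measurable (F (\<tau> n))"
    and "integrable M (\<lambda>\<omega>. (elementary_integral W n \<tau> \<xi> \<omega>)\<^sup>2)"
    and "expectation (elementary_integral W n \<tau> \<xi>) = 0"
    and "expectation (\<lambda>\<omega>. (elementary_integral W n \<tau> \<xi> \<omega>)\<^sup>2) =
      (\<Sum>i<n. expectation (\<lambda>\<omega>. (\<xi> i \<omega>)\<^sup>2) * (\<tau> (Suc i) - \<tau> i))"
proof -
  let ?S = "\<lambda>n. elementary_integral W n \<tau> \<xi>"
  have "?S n \<in> borel_measurable (F (\<tau> n)) \<and> integrable M (\<lambda>\<omega>. (?S n \<omega>)\<^sup>2) \<and>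
      expectation (?S n) = 0 \<and>
      expectation (\<lambda>\<omega>. (?S n \<omega>)\<^sup>2) = (\<Sum>i<n. expectation (\<lambda>\<omega>. (\<xi> i \<omega>)\<^sup>2) * (\<tau> (Suc i) - \<tau> i))"
    using assms(2)
  proof (induction n)
    case 0
    show ?case by (simp add: elementary_integral_def[abs_def])
  next
    case (Suc n)
    note IH = Suc.IH[OF elementary_data_Suc[OF Suc.prems]]
    let ?D = "\<lambda>\<omega>. W (\<tau> (Suc n)) \<omega> - W (\<tau> n) \<omega>"
    have \<tau>: "0 \<le> \<tau> n" "\<tau> n \<le> \<tau> (Suc n)"
      using elementary_data_partition[OF Suc.prems, of n] \<open>0 \<le> a\<close> by auto
    note weight = elementary_weight[OF Suc.prems lessI]
    note \<xi> = weight(1)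
    obtain B where B: "\<And>\<omega>. \<omega> \<in> space M \<Longrightarrow> \<bar>\<xi> n \<omega>\<bar> \<le> B"
      using weight(4) by blast
    have split: "?S (Suc n) = (\<lambda>\<omega>. ?S n \<omega> + \<xi> n \<omega> * ?D \<omega>)"
      by (simp add: elementary_integral_def fun_eq_iff)
    have S: "?S n \<in> borel_measurable (F (\<tau> n))" and S2: "integrable M (\<lambda>\<omega>. (?S n \<omega>)\<^sup>2)"
      using IH by auto
    have [measurable]: "\<xi> n \<in> borel_measurable M" "?S n \<in> borel_measurable M"
      using \<xi> S borel_measurable_F_imp_M by auto
    have S1: "integrable M (?S n)"
      by (rule square_integrable_imp_integrable[OF _ S2]) simp
    have i3: "integrable M (\<lambda>\<omega>. 2 * ?S n \<omega> * \<xi> n \<omega>)"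
    proof (rule Bochner_Integration.integrable_bound)
      show "integrable M (\<lambda>\<omega>. 2 * B * ?S n \<omega>)"
        using S1 by simp
      show "AE \<omega> in M. norm (2 * ?S n \<omega> * \<xi> n \<omega>) \<le> norm (2 * B * ?S n \<omega>)"
      proof (rule AE_I2)
        fix \<omega> assume "\<omega> \<in> space M"
        then have "\<bar>\<xi> n \<omega>\<bar> * \<bar>?S n \<omega>\<bar> \<le> \<bar>B\<bar> * \<bar>?S n \<omega>\<bar>"
          using B by (intro mult_right_mono) force+
        then show "norm (2 * ?S n \<omega> * \<xi> n \<omega>) \<le> norm (2 * B * ?S n \<omega>)"
          by (simp add: abs_mult mult.commute)
      qed
    qed simp
    note e1 = expectation_past_times_increment[OF \<tau> \<xi> weight(2)]
    note e2 = expectation_past_times_increment[OF \<tau> borel_measurable_power[OF \<xi>] weight(3)]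
    have "(\<lambda>\<omega>. 2 * ?S n \<omega> * \<xi> n \<omega>) \<in> borel_measurable (F (\<tau> n))"
      using S \<xi> by simp
    note e3 = expectation_past_times_increment[OF \<tau> this i3]
    have sq: "(\<lambda>\<omega>. (?S (Suc n) \<omega>)\<^sup>2) =
        (\<lambda>\<omega>. (?S n \<omega>)\<^sup>2 + 2 * ?S n \<omega> * \<xi> n \<omega> * ?D \<omega> + (\<xi> n \<omega>)\<^sup>2 * (?D \<omega>)\<^sup>2)"
      by (simp add: split fun_eq_iff power2_sum power_mult_distrib)
    show ?case
    proof (intro conjI)
      show "?S (Suc n) \<in> borel_measurable (F (\<tau> (Suc n)))"
        unfolding split
        by (intro borel_measurable_add borel_measurable_times borel_measurable_increment \<tau>
            borel_measurable_F_mono[OF \<tau>(2) S] borel_measurable_F_mono[OF \<tau>(2) \<xi>])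
      show "integrable M (\<lambda>\<omega>. (?S (Suc n) \<omega>)\<^sup>2)"
        unfolding sq using S2 e2(3) e3(1) by simp
      show "expectation (?S (Suc n)) = 0"
        unfolding split using IH S1 e1(1,2) by simp
      show "expectation (\<lambda>\<omega>. (?S (Suc n) \<omega>)\<^sup>2) =
          (\<Sum>i<Suc n. expectation (\<lambda>\<omega>. (\<xi> i \<omega>)\<^sup>2) * (\<tau> (Suc i) - \<tau> i))"
        unfolding sq using IH S2 e2(3,4) e3(1,2) by simp
    qed
  qed
  then show "?S n \<in> borel_measurable (F (\<tau> n))" "integrable M (\<lambda>\<omega>. (?S n \<omega>)\<^sup>2)"
    "expectation (?S n) = 0"
    "expectation (\<lambda>\<omega>. (?S n \<omega>)\<^sup>2) = (\<Sum>i<n. expectation (\<lambda>\<omega>. (\<xi> i \<omega>)\<^sup>2) * (\<tau> (Suc i) - \<tau> i))"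
    by auto
qed

lemma borel_measurable_elementary_process:
  assumes "elementary_data M F a b n \<tau> \<xi>"
  shows "(\<lambda>(s, \<omega>). elementary_process n \<tau> \<xi> s \<omega>) \<in> borel_measurable (lborel \<Otimes>\<^sub>M M)"
proof -
  have "(\<lambda>z. \<xi> i (snd z) * indicator {\<tau> i<..\<tau> (Suc i)} (fst z)) \<in> borel_measurable (lborel \<Otimes>\<^sub>M M)"
    if "i < n" for i
  proof -
    have [measurable]: "\<xi> i \<in> borel_measurable M"
      using assms that borel_measurable_F_imp_M by (auto simp: elementary_data_def)
    show ?thesis by measurable
  qed
  then show ?thesis
    unfolding elementary_process_def case_prod_beta by (intro borel_measurable_sum) auto
qed

lemma elementary_process_square_integral:
  assumes "elementary_data M F a b n \<tau> \<xi>"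
  shows "(\<integral>\<^sup>+(s, \<omega>). ennreal ((elementary_process n \<tau> \<xi> s \<omega>)\<^sup>2) \<partial>(lborel \<Otimes>\<^sub>M M)) =
    ennreal (\<Sum>i<n. expectation (\<lambda>\<omega>. (\<xi> i \<omega>)\<^sup>2) * (\<tau> (Suc i) - \<tau> i))"
  using assms
proof (induction n)
  case 0
  show ?case by (simp add: elementary_process_def)
next
  case (Suc n)
  note data = elementary_data_Suc[OF Suc.prems]
  let ?J = "{\<tau> n<..\<tau> (Suc n)}"
  let ?E = "\<lambda>i. expectation (\<lambda>\<omega>. (\<xi> i \<omega>)\<^sup>2)"
  have \<tau>: "\<tau> i \<le> \<tau> (Suc i)" if "i < Suc n" for i
    using Suc.prems that by (simp add: elementary_data_def)
  note int = elementary_weight(3)[OF Suc.prems lessI]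
  have [measurable]: "\<xi> n \<in> borel_measurable M"
    by (rule borel_measurable_F_imp_M[OF elementary_weight(1)[OF Suc.prems lessI]])
  have [measurable]: "(\<lambda>z. elementary_process n \<tau> \<xi> (fst z) (snd z)) \<in> borel_measurable (lborel \<Otimes>\<^sub>M M)"
    using borel_measurable_elementary_process[OF data] by (simp add: case_prod_beta)
  \<comment> \<open>the cross term vanishes because the two parts live on disjoint time intervals\<close>
  have sq: "(elementary_process (Suc n) \<tau> \<xi> s \<omega>)\<^sup>2 =
      (elementary_process n \<tau> \<xi> s \<omega>)\<^sup>2 + (\<xi> n \<omega>)\<^sup>2 * indicator ?J s" for s \<omega>
  proof (cases "s \<in> ?J")
    case True
    then have "elementary_process n \<tau> \<xi> s \<omega> = 0"
      by (intro elementary_process_outside[OF data]) auto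
    with True show ?thesis by (simp add: elementary_process_def)
  qed (simp add: elementary_process_def)
  have "(\<integral>\<^sup>+(s, \<omega>). ennreal ((elementary_process (Suc n) \<tau> \<xi> s \<omega>)\<^sup>2) \<partial>(lborel \<Otimes>\<^sub>M M)) =
      (\<integral>\<^sup>+z. ennreal ((elementary_process n \<tau> \<xi> (fst z) (snd z))\<^sup>2) +
        ennreal ((\<xi> n (snd z))\<^sup>2) * indicator ?J (fst z) \<partial>(lborel \<Otimes>\<^sub>M M))"
    by (auto intro!: nn_integral_cong simp: sq ennreal_plus ennreal_mult ennreal_indicator)
  also have "\<dots> = (\<integral>\<^sup>+z. ennreal ((elementary_process n \<tau> \<xi> (fst z) (snd z))\<^sup>2) \<partial>(lborel \<Otimes>\<^sub>M M)) +
      (\<integral>\<^sup>+z. ennreal ((\<xi> n (snd z))\<^sup>2) * indicator ?J (fst z) \<partial>(lborel \<Otimes>\<^sub>M M))"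
    by (rule nn_integral_add) measurable
  also have "(\<integral>\<^sup>+z. ennreal ((\<xi> n (snd z))\<^sup>2) * indicator ?J (fst z) \<partial>(lborel \<Otimes>\<^sub>M M)) =
      (\<integral>\<^sup>+s. \<integral>\<^sup>+\<omega>. ennreal ((\<xi> n \<omega>)\<^sup>2) * indicator ?J s \<partial>M \<partial>lborel)"
    by (subst nn_integral_fst[symmetric]) simp_all
  also have "\<dots> = ennreal (?E n) * (\<integral>\<^sup>+s. indicator ?J s \<partial>lborel)"
    by (simp add: nn_integral_multc nn_integral_cmult nn_integral_eq_integral[OF int])
  also have "\<dots> = ennreal (?E n * (\<tau> (Suc n) - \<tau> n))"
    using \<tau>[of n] by (simp add: ennreal_mult integral_nonneg_AE)
  also have "(\<integral>\<^sup>+z. ennreal ((elementary_process n \<tau> \<xi> (fst z) (snd z))\<^sup>2) \<partial>(lborel \<Otimes>\<^sub>M M)) =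
      ennreal (\<Sum>i<n. ?E i * (\<tau> (Suc i) - \<tau> i))"
    using Suc.IH[OF data] by (simp add: case_prod_beta)
  also have "\<dots> + ennreal (?E n * (\<tau> (Suc n) - \<tau> n)) =
      ennreal (\<Sum>i<Suc n. ?E i * (\<tau> (Suc i) - \<tau> i))"
  proof -
    have "0 \<le> ?E i * (\<tau> (Suc i) - \<tau> i)" if "i < Suc n" for i
      using \<tau>[OF that] by (intro mult_nonneg_nonneg integral_nonneg_AE) auto
    then show ?thesis
      by (subst ennreal_plus[symmetric]) (auto intro!: sum_nonneg)
  qed
  finally show ?case .
qed

lemma elementary_isometry:
  assumes "0 \<le> a" "elementary_data M F a b n \<tau> \<xi>"
  shows "(\<integral>\<^sup>+\<omega>. ennreal ((elementary_integral W n \<tau> \<xi> \<omega>)\<^sup>2) \<partial>M) =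
    (\<integral>\<^sup>+(s, \<omega>). ennreal ((elementary_process n \<tau> \<xi> s \<omega>)\<^sup>2) \<partial>(lborel \<Otimes>\<^sub>M M))"
  by (simp add: elementary_process_square_integral[OF assms(2)] nn_integral_eq_integral
      elementary_integral_moments[OF assms])

section \<open>The Ito integral: isometry and mean\<close>

text \<open>
  The predictable \<open>\<sigma>\<close>-algebra lives on \<open>[a, \<infinity>) \<times> \<Omega>\<close> only; cutting off below \<open>a\<close> makes the process a
  measurable function on the whole product space, where Tonelli's theorem applies.
\<close>

lemma predictable_imp_jointly_measurable:
  assumes "predictable_process M F a X"
  shows "(\<lambda>(s, \<omega>). indicator {a..} s * X s \<omega>) \<in> borel_measurable (lborel \<Otimes>\<^sub>M M)"
proof -
  let ?\<Omega> = "{a..} \<times> space M"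
  have F_M: "A \<in> sets M" if "A \<in> sets (F t)" for A t
    using that subalgebra_F[of t] by (auto simp: subalgebra_def)
  have space: "space (lborel \<Otimes>\<^sub>M M) = UNIV \<times> space M"
    by (simp add: space_pair_measure)
  have \<Omega>: "?\<Omega> \<inter> space (lborel \<Otimes>\<^sub>M M) = ?\<Omega>" "?\<Omega> \<in> sets (lborel \<Otimes>\<^sub>M M)"
    by (auto simp: space)
  have "(\<lambda>z. z) \<in> restrict_space (lborel \<Otimes>\<^sub>M M) ?\<Omega> \<rightarrow>\<^sub>M predictable_algebra M F a"
    unfolding predictable_algebra_def
  proof (rule measurable_measure_of)
    fix y assume "y \<in> {{a} \<times> A |A. A \<in> sets (F a)} \<union>
      {{s<..t} \<times> A |s t A. a \<le> s \<and> s \<le> t \<and> A \<in> sets (F s)}"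
    then have "y \<in> sets (lborel \<Otimes>\<^sub>M M) \<and> y \<subseteq> ?\<Omega>"
      using F_M sets.sets_into_space by (fastforce intro!: pair_measureI)
    then show "(\<lambda>z. z) -` y \<inter> space (restrict_space (lborel \<Otimes>\<^sub>M M) ?\<Omega>)
        \<in> sets (restrict_space (lborel \<Otimes>\<^sub>M M) ?\<Omega>)"
      using \<Omega> by (auto simp: sets_restrict_space space_restrict_space)
  qed (use F_M sets.sets_into_space in \<open>fastforce simp: space_restrict_space space\<close>)+
  then have "(\<lambda>z. case z of (s, \<omega>) \<Rightarrow> X s \<omega>) \<in> borel_measurable (restrict_space (lborel \<Otimes>\<^sub>M M) ?\<Omega>)"
    using assms unfolding predictable_process_def by (rule measurable_compose)
  then have "(\<lambda>z. indicator ?\<Omega> z *\<^sub>R (case z of (s, \<omega>) \<Rightarrow> X s \<omega>)) \<in> borel_measurable (lborel \<Otimes>\<^sub>M M)"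
    by (subst (asm) borel_measurable_restrict_space_iff) (use \<Omega> in auto)
  then show ?thesis
    by (rule measurable_cong[THEN iffD1, rotated]) (auto simp: space indicator_def)
qed

lemma ito_integrand_measurable:
  assumes "has_ito_integral M F W a b H I"
  shows "(\<lambda>(s, \<omega>). indicator {a..b} s * H s \<omega>) \<in> borel_measurable (lborel \<Otimes>\<^sub>M M)"
proof -
  have "predictable_process M F a (\<lambda>s \<omega>. indicator {a..b} s * H s \<omega>)"
    using assms by (simp add: has_ito_integral_def)
  from predictable_imp_jointly_measurable[OF this] show ?thesis
    by (rule measurable_cong[THEN iffD1, rotated]) (auto simp: indicator_def)
qed

lemma ito_integrand_square_measurable:
  assumes "has_ito_integral M F W a b H I"
  shows "(\<lambda>s. (\<integral>\<^sup>+\<omega>. ennreal ((H s \<omega>)\<^sup>2) \<partial>M) * indicator {a..b} s) \<in> borel_measurable lborel"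
proof -
  note [measurable] = ito_integrand_measurable[OF assms]
  have "(\<lambda>z. ennreal (((\<lambda>(s, \<omega>). indicator {a..b} s * H s \<omega>) z)\<^sup>2)) \<in> borel_measurable (lborel \<Otimes>\<^sub>M M)"
    by measurable
  from borel_measurable_nn_integral_fst[OF this] show ?thesis
    by (rule measurable_cong[THEN iffD1, rotated]) (simp add: indicator_def)
qed

text \<open>
  The elementary isometry identifies two sequences of \<open>L\<^sup>2\<close> norms, one over \<open>M\<close> and one over the product
  space.  An elementary integrand vanishes outside \<open>[a, b]\<close>, so its distance to \<open>H\<close> over \<open>[a, b]\<close> is
  the distance on the whole product space to \<open>H\<close> cut off outside \<open>[a, b]\<close>.
\<close>

theorem ito_isometry:
  assumes "0 \<le> a" "has_ito_integral M F W a b H I"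
  shows "(\<integral>\<^sup>+\<omega>. ennreal ((I \<omega>)\<^sup>2) \<partial>M) =
    (\<integral>\<^sup>+s\<in>{a..b}. (\<integral>\<^sup>+\<omega>. ennreal ((H s \<omega>)\<^sup>2) \<partial>M) \<partial>lborel)"
proof -
  obtain n \<tau> \<xi> where data: "\<And>k. elementary_data M F a b (n k) (\<tau> k) (\<xi> k)"
    and limH: "(\<lambda>k. \<integral>\<^sup>+s\<in>{a..b}. (\<integral>\<^sup>+\<omega>. ennreal ((elementary_process (n k) (\<tau> k) (\<xi> k) s \<omega> - H s \<omega>)\<^sup>2) \<partial>M)
        \<partial>lborel) \<longlonglongrightarrow> 0"
    and limI: "(\<lambda>k. \<integral>\<^sup>+\<omega>. ennreal ((elementary_integral W (n k) (\<tau> k) (\<xi> k) \<omega> - I \<omega>)\<^sup>2) \<partial>M) \<longlonglongrightarrow> 0"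
    using assms(2) unfolding has_ito_integral_def by blast
  have [measurable]: "I \<in> borel_measurable M"
    using assms(2) by (simp add: has_ito_integral_def)
  note B[measurable] = ito_integrand_measurable[OF assms(2)]
  have A[measurable]: "(\<lambda>(s, \<omega>). elementary_process (n k) (\<tau> k) (\<xi> k) s \<omega>) \<in> borel_measurable (lborel \<Otimes>\<^sub>M M)" for k
    by (rule borel_measurable_elementary_process[OF data])
  have S[measurable]: "elementary_integral W (n k) (\<tau> k) (\<xi> k) \<in> borel_measurable M" for k
    using elementary_integral_moments(1)[OF assms(1) data] borel_measurable_F_imp_M by blast
  have out: "elementary_process (n k) (\<tau> k) (\<xi> k) s \<omega> = 0" if "s \<notin> {a..b}" for k s \<omega>
    using that data[of k]
    by (intro elementary_process_outside[OF data]) (auto simp: elementary_data_def)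
  have dist: "(\<integral>\<^sup>+z. ennreal (((\<lambda>(s, \<omega>). elementary_process (n k) (\<tau> k) (\<xi> k) s \<omega>) z -
        (\<lambda>(s, \<omega>). indicator {a..b} s * H s \<omega>) z)\<^sup>2) \<partial>(lborel \<Otimes>\<^sub>M M)) =
      (\<integral>\<^sup>+s\<in>{a..b}. (\<integral>\<^sup>+\<omega>. ennreal ((elementary_process (n k) (\<tau> k) (\<xi> k) s \<omega> - H s \<omega>)\<^sup>2) \<partial>M) \<partial>lborel)"
    for k
  proof -
    have "(\<lambda>z. ennreal (((\<lambda>(s, \<omega>). elementary_process (n k) (\<tau> k) (\<xi> k) s \<omega>) z -
        (\<lambda>(s, \<omega>). indicator {a..b} s * H s \<omega>) z)\<^sup>2)) \<in> borel_measurable (lborel \<Otimes>\<^sub>M M)"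
      by measurable
    from nn_integral_fst[OF this, symmetric] show ?thesis
      by (auto intro!: nn_integral_cong simp: indicator_def out)
  qed
  have "(\<integral>\<^sup>+\<omega>. ennreal ((I \<omega>)\<^sup>2) \<partial>M) =
      (\<integral>\<^sup>+z. ennreal (((\<lambda>(s, \<omega>). indicator {a..b} s * H s \<omega>) z)\<^sup>2) \<partial>(lborel \<Otimes>\<^sub>M M))"
  proof (rule L2_limit_isometry[OF S _ A B _ limI])
    show "(\<integral>\<^sup>+\<omega>. ennreal ((elementary_integral W (n k) (\<tau> k) (\<xi> k) \<omega>)\<^sup>2) \<partial>M) =
      (\<integral>\<^sup>+z. ennreal (((\<lambda>(s, \<omega>). elementary_process (n k) (\<tau> k) (\<xi> k) s \<omega>) z)\<^sup>2) \<partial>(lborel \<Otimes>\<^sub>M M))" for k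
      using elementary_isometry[OF assms(1) data[of k]] by (simp add: case_prod_unfold)
  qed (use limH in \<open>simp_all only: dist\<close>, simp)
  also have "\<dots> = (\<integral>\<^sup>+s\<in>{a..b}. (\<integral>\<^sup>+\<omega>. ennreal ((H s \<omega>)\<^sup>2) \<partial>M) \<partial>lborel)"
  proof -
    have "(\<lambda>z. ennreal (((\<lambda>(s, \<omega>). indicator {a..b} s * H s \<omega>) z)\<^sup>2)) \<in> borel_measurable (lborel \<Otimes>\<^sub>M M)"
      by measurable
    from nn_integral_fst[OF this, symmetric] show ?thesis
      by (auto intro!: nn_integral_cong simp: indicator_def)
  qed
  finally show ?thesis .
qed

text \<open>
  The elementary integrals have mean zero, so \<open>(E I)\<^sup>2\<close> is the squared mean of the approximation error
  and is dominated by its second moment.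
\<close>

lemma expectation_ito_integral:
  assumes "0 \<le> a" "has_ito_integral M F W a b H I" and I2: "integrable M (\<lambda>\<omega>. (I \<omega>)\<^sup>2)"
  shows "expectation I = 0"
proof -
  obtain n \<tau> \<xi> where data: "\<And>k. elementary_data M F a b (n k) (\<tau> k) (\<xi> k)"
    and limI: "(\<lambda>k. \<integral>\<^sup>+\<omega>. ennreal ((elementary_integral W (n k) (\<tau> k) (\<xi> k) \<omega> - I \<omega>)\<^sup>2) \<partial>M) \<longlonglongrightarrow> 0"
    using assms(2) unfolding has_ito_integral_def by blast
  have [measurable]: "I \<in> borel_measurable M"
    using assms(2) by (simp add: has_ito_integral_def)
  have I1: "integrable M I"
    by (rule square_integrable_imp_integrable[OF _ I2]) simp
  have le: "ennreal ((expectation I)\<^sup>2) \<le>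
      (\<integral>\<^sup>+\<omega>. ennreal ((elementary_integral W (n k) (\<tau> k) (\<xi> k) \<omega> - I \<omega>)\<^sup>2) \<partial>M)" for k
  proof -
    let ?S = "elementary_integral W (n k) (\<tau> k) (\<xi> k)"
    let ?Z = "\<lambda>\<omega>. ?S \<omega> - I \<omega>"
    note S = elementary_integral_moments[OF assms(1) data[of k]]
    have [measurable]: "?S \<in> borel_measurable M"
      using S(1) borel_measurable_F_imp_M by blast
    have S1: "integrable M ?S"
      by (rule square_integrable_imp_integrable[OF _ S(2)]) simp
    have Z2: "integrable M (\<lambda>\<omega>. (?Z \<omega>)\<^sup>2)"
    proof (rule Bochner_Integration.integrable_bound)
      show "integrable M (\<lambda>\<omega>. 2 * (?S \<omega>)\<^sup>2 + 2 * (I \<omega>)\<^sup>2)"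
        using S(2) I2 by simp
      have "(x - y)\<^sup>2 \<le> 2 * x\<^sup>2 + 2 * y\<^sup>2" for x y :: real
        using zero_le_power2[of "x + y"] by (simp add: power2_eq_square algebra_simps)
      then show "AE \<omega> in M. norm ((?Z \<omega>)\<^sup>2) \<le> norm (2 * (?S \<omega>)\<^sup>2 + 2 * (I \<omega>)\<^sup>2)"
        by simp
    qed simp
    have "expectation ?Z = - expectation I"
      using S1 I1 S(3) by simp
    then have "(expectation ?Z)\<^sup>2 = (expectation I)\<^sup>2"
      by simp
    moreover have "0 \<le> variance ?Z"
      by (rule variance_positive)
    moreover have "variance ?Z = expectation (\<lambda>\<omega>. (?Z \<omega>)\<^sup>2) - (expectation ?Z)\<^sup>2"
      using S1 I1 Z2 by (intro variance_eq) auto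
    ultimately have "(expectation I)\<^sup>2 \<le> expectation (\<lambda>\<omega>. (?Z \<omega>)\<^sup>2)"
      by linarith
    then show ?thesis
      by (simp add: nn_integral_eq_integral[OF Z2] ennreal_leI)
  qed
  have "ennreal ((expectation I)\<^sup>2) \<le> 0"
    by (rule LIMSEQ_le_const[OF limI]) (use le in auto)
  then show ?thesis by simp
qed

text \<open>
  Mean zero of \<open>I\<close> removes the cross term from the second moment of \<open>v + k I\<close>; the isometry
  evaluates the remaining one.
\<close>

lemma ito_second_moment:
  assumes "0 \<le> a" "has_ito_integral M F W a b H I" and k: "k \<noteq> 0"
    and X: "AE \<omega> in M. X \<omega> = v + k * I \<omega>"
    and X2: "integrable M (\<lambda>\<omega>. (X \<omega>)\<^sup>2)" and [measurable]: "X \<in> borel_measurable M"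
  shows "(\<integral>\<^sup>+\<omega>. ennreal ((X \<omega>)\<^sup>2) \<partial>M) =
    ennreal (v\<^sup>2) + ennreal (k\<^sup>2) * (\<integral>\<^sup>+s\<in>{a..b}. (\<integral>\<^sup>+\<omega>. ennreal ((H s \<omega>)\<^sup>2) \<partial>M) \<partial>lborel)"
proof -
  have [measurable]: "I \<in> borel_measurable M"
    using assms(2) by (simp add: has_ito_integral_def)
  have X1: "integrable M X"
    by (rule square_integrable_imp_integrable[OF _ X2]) simp
  \<comment> \<open>\<open>I = (X - v) / k\<close> inherits square integrability from \<open>X\<close>\<close>
  have "integrable M (\<lambda>\<omega>. ((X \<omega>)\<^sup>2 - 2 * v * X \<omega> + v\<^sup>2) / k\<^sup>2)"
    using X1 X2 by simp
  then have I2: "integrable M (\<lambda>\<omega>. (I \<omega>)\<^sup>2)"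
    by (rule integrable_cong_AE_imp)
      (use X k in \<open>auto elim!: eventually_mono simp: field_simps power2_eq_square\<close>)
  have I1: "integrable M I"
    by (rule square_integrable_imp_integrable[OF _ I2]) simp
  have "expectation (\<lambda>\<omega>. (X \<omega>)\<^sup>2) = expectation (\<lambda>\<omega>. v\<^sup>2 + 2 * v * k * I \<omega> + k\<^sup>2 * (I \<omega>)\<^sup>2)"
    by (rule integral_cong_AE)
      (use X in \<open>auto elim!: eventually_mono simp: power2_eq_square algebra_simps\<close>)
  also have "\<dots> = v\<^sup>2 + k\<^sup>2 * expectation (\<lambda>\<omega>. (I \<omega>)\<^sup>2)"
    using I1 I2 expectation_ito_integral[OF assms(1,2) I2] by (simp add: prob_space)
  finally have "(\<integral>\<^sup>+\<omega>. ennreal ((X \<omega>)\<^sup>2) \<partial>M) = ennreal (v\<^sup>2 + k\<^sup>2 * expectation (\<lambda>\<omega>. (I \<omega>)\<^sup>2))"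
    by (simp add: nn_integral_eq_integral[OF X2])
  also have "\<dots> = ennreal (v\<^sup>2) + ennreal (k\<^sup>2) * (\<integral>\<^sup>+\<omega>. ennreal ((I \<omega>)\<^sup>2) \<partial>M)"
    by (simp add: nn_integral_eq_integral[OF I2] ennreal_plus ennreal_mult)
  finally show ?thesis
    by (simp add: ito_isometry[OF assms(1,2)])
qed

end

section \<open>A reverse Gronwall inequality\<close>

lemma DERIV_exp_partial_sum:
  "((\<lambda>y::real. \<Sum>j<Suc n. y ^ j / fact j) has_real_derivative (\<Sum>j<n. y ^ j / fact j)) (at y)"
proof (induction n)
  case (Suc n)
  have "((\<lambda>y::real. y ^ Suc n / fact (Suc n)) has_real_derivative (y ^ n / fact n)) (at y)"
    using DERIV_cdivide[OF DERIV_pow[of "Suc n" y], of "fact (Suc n)"] by (simp del: of_nat_Suc)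
  from DERIV_add[OF Suc.IH this] show ?case by simp
qed simp

text \<open>
  With \<open>\<phi>(t) = (\<kappa> / \<beta>) (t - a)\<^bsup>\<beta>\<^esup>\<close>, a primitive of the kernel, a lower bound by \<open>C\<close> times a partial sum
  of \<open>exp \<phi>\<close> reproduces itself with one more term when it is inserted under the integral.  The
  singularity of the kernel at \<open>a\<close> is harmless because \<open>\<phi>\<close> is continuous there.
\<close>

lemma reverse_gronwall_powr:
  fixes g :: "real \<Rightarrow> ennreal" and a \<beta> \<kappa> C :: real
  assumes "0 < \<beta>" "0 \<le> \<kappa>" "0 \<le> C"
    and g: "\<And>t. a \<le> t \<Longrightarrow>
      ennreal C + (\<integral>\<^sup>+s\<in>{a..t}. ennreal (\<kappa> * (s - a) powr (\<beta> - 1)) * g s \<partial>lborel) \<le> g t"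
    and "a \<le> t"
  shows "ennreal (C * exp (\<kappa> / \<beta> * (t - a) powr \<beta>)) \<le> g t"
proof -
  define \<phi> where "\<phi> = (\<lambda>t. \<kappa> / \<beta> * (t - a) powr \<beta>)"
  define P where "P = (\<lambda>n y. \<Sum>j<n. y ^ j / fact j :: real)"
  define k where "k = (\<lambda>s. \<kappa> * (s - a) powr (\<beta> - 1))"
  have \<phi>_nonneg: "0 \<le> \<phi> t" for t
    using assms by (simp add: \<phi>_def)
  have P_nonneg: "0 \<le> P n y" if "0 \<le> y" for n y
    using that by (auto simp: P_def intro!: sum_nonneg)
  have k_nonneg: "0 \<le> k s" for s
    using assms by (simp add: k_def)
  have P_deriv: "(P (Suc n) has_real_derivative P n y) (at y)" for n y
    unfolding P_def by (rule DERIV_exp_partial_sum)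
  have iterate: "(\<integral>\<^sup>+s\<in>{a..t}. ennreal (k s * (C * P n (\<phi> s))) \<partial>lborel) = ennreal (C * P (Suc n) (\<phi> t) - C)"
    if "a \<le> t" for n t
  proof -
    have \<phi>_cont: "continuous_on {a..t} \<phi>"
      unfolding \<phi>_def using \<open>0 < \<beta>\<close> by (intro continuous_intros continuous_on_powr') auto
    have "((\<lambda>s. k s * (C * P n (\<phi> s))) has_integral C * P (Suc n) (\<phi> t) - C * P (Suc n) (\<phi> a)) {a..t}"
    proof (rule fundamental_theorem_of_calculus_interior[OF that])
      show "continuous_on {a..t} (\<lambda>s. C * P (Suc n) (\<phi> s))"
        unfolding P_def by (intro continuous_intros \<phi>_cont) auto
      fix s assume s: "s \<in> {a<..<t}"
      have "(\<phi> has_real_derivative k s) (at s)"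
        unfolding \<phi>_def k_def using s \<open>0 < \<beta>\<close> by (auto intro!: derivative_eq_intros)
      from DERIV_chain2[OF P_deriv this]
      have "((\<lambda>s. C * P (Suc n) (\<phi> s)) has_real_derivative C * (P n (\<phi> s) * k s)) (at s)"
        by (rule DERIV_cmult)
      then show "((\<lambda>s. C * P (Suc n) (\<phi> s)) has_vector_derivative k s * (C * P n (\<phi> s))) (at s)"
        by (simp add: has_real_derivative_iff_has_vector_derivative mult_ac)
    qed
    moreover have "P (Suc n) (\<phi> a) = 1"
      using \<open>0 < \<beta>\<close> unfolding P_def \<phi>_def by (subst sum.lessThan_Suc_shift) simp
    ultimately show ?thesis
      using P_nonneg[OF \<phi>_nonneg] k_nonneg \<open>0 \<le> C\<close>
      by (intro nn_integral_has_integral_lebesgue') auto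
  qed
  have partial: "ennreal (C * P n (\<phi> t)) \<le> g t" if "a \<le> t" for n t
    using that
  proof (induction n arbitrary: t)
    case 0
    show ?case by (simp add: P_def)
  next
    case (Suc n)
    have "1 \<le> P (Suc n) (\<phi> t)"
    proof -
      have "P (Suc n) (\<phi> t) = 1 + (\<Sum>j<n. \<phi> t ^ Suc j / fact (Suc j))"
        unfolding P_def by (subst sum.lessThan_Suc_shift) simp
      moreover have "0 \<le> (\<Sum>j<n. \<phi> t ^ Suc j / fact (Suc j))"
        using \<phi>_nonneg by (intro sum_nonneg) auto
      ultimately show ?thesis by simp
    qed
    then have "C \<le> C * P (Suc n) (\<phi> t)"
      using \<open>0 \<le> C\<close> by (simp add: mult_le_cancel_left1)
    then have "ennreal (C * P (Suc n) (\<phi> t)) = ennreal C + ennreal (C * P (Suc n) (\<phi> t) - C)"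
      using \<open>0 \<le> C\<close> by (subst ennreal_plus[symmetric]) auto
    also have "\<dots> = ennreal C + (\<integral>\<^sup>+s\<in>{a..t}. ennreal (k s * (C * P n (\<phi> s))) \<partial>lborel)"
      by (simp only: iterate[OF Suc.prems])
    also have "\<dots> \<le> ennreal C + (\<integral>\<^sup>+s\<in>{a..t}. ennreal (k s) * g s \<partial>lborel)"
    proof (intro add_left_mono nn_integral_mono)
      fix s
      show "ennreal (k s * (C * P n (\<phi> s))) * indicator {a..t} s \<le> ennreal (k s) * g s * indicator {a..t} s"
        using Suc.IH[of s] k_nonneg[of s]
        by (auto simp: indicator_def ennreal_mult' intro!: mult_left_mono)
    qed
    also have "\<dots> \<le> g t"
      using g[OF Suc.prems] by (simp add: k_def)
    finally show ?case .
  qed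
  have "(\<lambda>n. P n (\<phi> t)) \<longlonglongrightarrow> exp (\<phi> t)"
    using exp_converges[of "\<phi> t"] by (simp add: sums_def P_def field_simps)
  then have "(\<lambda>n. ennreal (C * P n (\<phi> t))) \<longlonglongrightarrow> ennreal (C * exp (\<phi> t))"
    by (intro tendsto_ennrealI tendsto_mult_left)
  then have "ennreal (C * exp (\<phi> t)) \<le> g t"
    by (rule LIMSEQ_le_const2) (use partial[OF \<open>a \<le> t\<close>] in auto)
  then show ?thesis by (simp add: \<phi>_def)
qed

section \<open>Growth of the second moment\<close>

theorem theorem3p11:
  fixes M :: "'a measure" and F :: "real \<Rightarrow> 'a measure" and W :: "real \<Rightarrow> 'a \<Rightarrow> real"
    and a \<alpha> lam c L :: real
    and u0 \<sigma> :: "real \<Rightarrow> real"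
    and u :: "real \<Rightarrow> real \<Rightarrow> 'a \<Rightarrow> real"
  assumes "wiener_process M F W"
    and "a > 0" and "1/2 < \<alpha>" and "\<alpha> < 1" and "lam > 0"
    and "\<And>x. u0 x \<ge> 0" and "bounded (range u0)"
    and "c > 0" and "\<And>x. u0 x > c"
    and "\<exists>K. K-lipschitz_on UNIV \<sigma>"
    and "L > 0" and "\<And>x. \<bar>\<sigma> x\<bar> \<ge> L * \<bar>x\<bar>"
    and "mild_solution M F W a \<alpha> lam \<sigma> u0 u"
    and "L2_continuous M a u"
  shows "\<exists>c3>0. \<forall>t\<ge>a.
    (INF x. (\<integral>\<omega>. \<bar>u x t \<omega>\<bar>\<^sup>2 \<partial>M))
      \<ge> c3 * exp (lam\<^sup>2 * L\<^sup>2 / (2 * \<alpha> - 1) * (t - a) powr (2 * \<alpha> - 1))"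
proof -
  interpret wiener_process M F W by fact
  have meas: "u x t \<in> borel_measurable M" and sq_int: "integrable M (\<lambda>\<omega>. (u x t \<omega>)\<^sup>2)" if "a \<le> t" for x t
    using \<open>L2_continuous M a u\<close> that by (auto simp: L2_continuous_def)
  define g where "g = (\<lambda>x t. \<integral>\<^sup>+\<omega>. ennreal ((u x t \<omega>)\<^sup>2) \<partial>M)"
  have renewal: "ennreal (c\<^sup>2) +
      (\<integral>\<^sup>+s\<in>{a..t}. ennreal (lam\<^sup>2 * L\<^sup>2 * (s - a) powr (2 * \<alpha> - 1 - 1)) * g x s \<partial>lborel) \<le> g x t"
    if t: "a \<le> t" for x t
  proof -
    let ?H = "\<lambda>s \<omega>. (s - a) powr (\<alpha> - 1) * \<sigma> (u x s \<omega>)"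
    obtain I where I: "has_ito_integral M F W a t ?H I"
      and eq: "AE \<omega> in M. u x t \<omega> = u0 x + lam * I \<omega>"
      using \<open>mild_solution M F W a \<alpha> lam \<sigma> u0 u\<close> t unfolding mild_solution_def by blast
    have pointwise: "L\<^sup>2 * (s - a) powr (2 * \<alpha> - 1 - 1) * y\<^sup>2 \<le> ((s - a) powr (\<alpha> - 1) * \<sigma> y)\<^sup>2" for s y
    proof -
      have "(L * \<bar>y\<bar>)\<^sup>2 \<le> \<bar>\<sigma> y\<bar>\<^sup>2"
        using assms(12)[of y] \<open>L > 0\<close> by (intro power_mono) auto
      then have "L\<^sup>2 * y\<^sup>2 \<le> (\<sigma> y)\<^sup>2"
        by (simp add: power_mult_distrib)
      moreover have "((s - a) powr (\<alpha> - 1))\<^sup>2 = (s - a) powr (2 * \<alpha> - 1 - 1)"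
        by (simp add: power2_eq_square powr_add[symmetric])
      ultimately show ?thesis
        using mult_left_mono[of "L\<^sup>2 * y\<^sup>2" "(\<sigma> y)\<^sup>2" "(s - a) powr (2 * \<alpha> - 1 - 1)"]
        by (simp add: power_mult_distrib mult_ac)
    qed
    have "ennreal (lam\<^sup>2 * L\<^sup>2 * (s - a) powr (2 * \<alpha> - 1 - 1)) * g x s \<le>
        ennreal (lam\<^sup>2) * (\<integral>\<^sup>+\<omega>. ennreal ((?H s \<omega>)\<^sup>2) \<partial>M)" if "s \<in> {a..t}" for s
    proof -
      have [measurable]: "u x s \<in> borel_measurable M"
        using meas that by simp
      have "ennreal (lam\<^sup>2 * L\<^sup>2 * (s - a) powr (2 * \<alpha> - 1 - 1)) * g x s =
          ennreal (lam\<^sup>2) * (\<integral>\<^sup>+\<omega>. ennreal (L\<^sup>2 * (s - a) powr (2 * \<alpha> - 1 - 1) * (u x s \<omega>)\<^sup>2) \<partial>M)"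
        by (simp add: g_def ennreal_mult nn_integral_cmult mult.assoc)
      also have "\<dots> \<le> ennreal (lam\<^sup>2) * (\<integral>\<^sup>+\<omega>. ennreal ((?H s \<omega>)\<^sup>2) \<partial>M)"
        by (intro mult_left_mono nn_integral_mono ennreal_leI pointwise) auto
      finally show ?thesis .
    qed
    then have "(\<integral>\<^sup>+s\<in>{a..t}. ennreal (lam\<^sup>2 * L\<^sup>2 * (s - a) powr (2 * \<alpha> - 1 - 1)) * g x s \<partial>lborel) \<le>
        (\<integral>\<^sup>+s\<in>{a..t}. ennreal (lam\<^sup>2) * (\<integral>\<^sup>+\<omega>. ennreal ((?H s \<omega>)\<^sup>2) \<partial>M) \<partial>lborel)"
      by (intro nn_integral_mono) (auto simp: indicator_def)
    also have "\<dots> = ennreal (lam\<^sup>2) * (\<integral>\<^sup>+s\<in>{a..t}. (\<integral>\<^sup>+\<omega>. ennreal ((?H s \<omega>)\<^sup>2) \<partial>M) \<partial>lborel)"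
      by (simp only: mult.assoc nn_integral_cmult[OF ito_integrand_square_measurable[OF I]])
    finally have "ennreal (c\<^sup>2) +
        (\<integral>\<^sup>+s\<in>{a..t}. ennreal (lam\<^sup>2 * L\<^sup>2 * (s - a) powr (2 * \<alpha> - 1 - 1)) * g x s \<partial>lborel) \<le>
        ennreal ((u0 x)\<^sup>2) +
        ennreal (lam\<^sup>2) * (\<integral>\<^sup>+s\<in>{a..t}. (\<integral>\<^sup>+\<omega>. ennreal ((?H s \<omega>)\<^sup>2) \<partial>M) \<partial>lborel)"
      using assms(8) assms(9)[of x] by (intro add_mono ennreal_leI power_mono) auto
    also have "\<dots> = g x t"
      unfolding g_def using \<open>a > 0\<close> \<open>lam > 0\<close>
      by (intro ito_second_moment[OF _ I _ eq sq_int[OF t] meas[OF t], symmetric]) auto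
    finally show ?thesis .
  qed
  have "c\<^sup>2 * exp (lam\<^sup>2 * L\<^sup>2 / (2 * \<alpha> - 1) * (t - a) powr (2 * \<alpha> - 1))
      \<le> (INF x. (\<integral>\<omega>. \<bar>u x t \<omega>\<bar>\<^sup>2 \<partial>M))" if t: "a \<le> t" for t
  proof (rule cINF_greatest)
    fix x
    have "ennreal (c\<^sup>2 * exp (lam\<^sup>2 * L\<^sup>2 / (2 * \<alpha> - 1) * (t - a) powr (2 * \<alpha> - 1))) \<le> g x t"
      using \<open>1 / 2 < \<alpha>\<close> renewal[of _ x] t by (intro reverse_gronwall_powr) auto
    also have "g x t = ennreal (\<integral>\<omega>. \<bar>u x t \<omega>\<bar>\<^sup>2 \<partial>M)"
      by (simp add: g_def nn_integral_eq_integral[OF sq_int[OF t]])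
    finally show "c\<^sup>2 * exp (lam\<^sup>2 * L\<^sup>2 / (2 * \<alpha> - 1) * (t - a) powr (2 * \<alpha> - 1))
        \<le> (\<integral>\<omega>. \<bar>u x t \<omega>\<bar>\<^sup>2 \<partial>M)"
      by (simp add: integral_nonneg_AE)
  qed simp
  moreover have "0 < c\<^sup>2"
    using \<open>c > 0\<close> by simp
  ultimately show ?thesis by blast
qed

end
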